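(* Let $V$ be a complex vector space of finite dimension $n\ge1$. The map $\Phi:\mathbb{P}M\to\mathrm{Map}(\mathbb{P}(V))$ is a monoid homomorphism, where $\mathrm{Map}(\mathbb{P}(V))$, the set of all maps from $\mathbb{P}(V)$ to itself, is a monoid with composition of maps as product. Hence the monoid $\mathbb{P}M$ acts on $\mathbb{P}(V)$ (via $\Phi$).
   Context: Overlines denote classes in projective spaces. $M$ is the set of all finite sequences $\mathcal{A}=(A_0,\ldots,A_m)$, $m\ge0$, such that $V_0=V$, each $A_i\in\mathrm{Hom}(V_i,V)$ is nonzero, $V_{i+1}=\mathrm{Ker}(A_i)$ for $0\le i\le m$, and $V_{m+1}=0$. Put $\mathbb{P}\mathcal{A}:=(\overline{A_0},\ldots,\overline{A_m})$ with $\overline{A_i}\in\mathbb{P}\mathrm{Hom}(V_i,V)$, and $\mathbb{P}M:=\{\mathbb{P}\mathcal{A}\mid\mathcal{A}\in M\}$. The map $\Phi$ is defined by $\Phi(\mathbb{P}\mathcal{A})(\overline{x})=\overline{A_ix}$ if $x\in V_i\setminus V_{i+1}$. Product on $\mathbb{P}M$. Let $\widetilde{M}'$ be the set of finite sequences $(A_0,\ldots,A_m)$, $m\ge0$, of elements of $\mathrm{End}(V)$ with $\bigcap_i\mathrm{Ker}(A_i)=0$. For $\mathcal{A}=(A_0,\ldots,A_{l-1})$ and $\mathcal{B}=(B_0,\ldots,B_{m-1})$ in $\widetilde{M}'$, $\mathcal{A}\mathcal{B}\in\widetilde{M}'$ is the sequence of length $lm$ whose entry at position $lj+i$ ($0\le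 i<l$, $0\le j<m$) is $A_iB_j$. Put $K(\mathcal{A})_i:=\bigcap_{k=0}^i\mathrm{Ker}(A_k)$, $K(\mathcal{A})_{-1}:=V$. Let $\Psi(\mathcal{A})$ be the subsequence of $\mathcal{A}$ consisting of those $A_i$ with $K(\mathcal{A})_{i}\subsetneq K(\mathcal{A})_{i-1}$. Let $\widetilde{M}\subseteq\widetilde{M}'$ be the set of sequences with $K(\mathcal{A})_i\subsetneq K(\mathcal{A})_{i-1}$ for all $i$; thus $\Psi(\mathcal{A})\in\widetilde{M}$. The product on $\widetilde{M}$ is $(\mathcal{A},\mathcal{B})\mapsto\Psi(\mathcal{A}\mathcal{B})$. The map $\pi:\widetilde{M}\to M$, $\pi(\mathcal{A})=(A_0,A_1|_{K(\mathcal{A})_0},\ldots,A_m|_{K(\mathcal{A})_{m-1}})$, is surjective, and the product on $\widetilde{M}$ descends along $\pi$ to $M$ and then along $\mathbb{P}$ to $\mathbb{P}M$: for $\mathcal{A},\mathcal{B}\in\widetilde{M}$, the product of $\mathbb{P}\pi(\mathcal{A})$ and $\mathbb{P}\pi(\mathcal{B})$ is $\mathbb{P}\pi(\Psi(\mathcal{A}\mathcal{B}))$ (well defined). The identity of $\mathbb{P}M$ is the one-term sequence $(\overline{\mathrm{id}_V})$. *)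

theory Defs
  imports Complex_Main "HOL-Algebra.Group"
begin

text \<open>Throughout, \<open>V\<close> is the whole type \<open>'v\<close>, with scalar multiplication
  \<open>s :: complex \<Rightarrow> 'v \<Rightarrow> 'v\<close>.\<close>

subsection \<open>Projective spaces\<close>

text \<open>The class of \<open>x\<close> modulo nonzero scalars, for an arbitrary scalar multiplication \<open>sc\<close>
  (used for \<open>V\<close> and for the spaces \<open>Hom(W, V)\<close>).\<close>

definition pclass :: "(complex \<Rightarrow> 'a \<Rightarrow> 'a) \<Rightarrow> 'a \<Rightarrow> 'a set" where
  "pclass sc x = {sc c x | c. c \<noteq> 0}"

definition PV :: "(complex \<Rightarrow> 'v::ab_group_add \<Rightarrow> 'v) \<Rightarrow> 'v set set" where
  "PV s = {pclass s x | x. x \<noteq> 0}"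

text \<open>\<open>Hom(W, V)\<close> for a subspace \<open>W\<close>: a map defined only on \<open>W\<close> is represented by an
  extensional function (with the value \<open>undefined\<close> outside \<open>W\<close>).\<close>

definition Hom :: "(complex \<Rightarrow> 'v::ab_group_add \<Rightarrow> 'v) \<Rightarrow> 'v set \<Rightarrow> ('v \<Rightarrow> 'v) set" where
  "Hom s W = {f \<in> extensional W.
     (\<forall>x\<in>W. \<forall>y\<in>W. f (x + y) = f x + f y) \<and> (\<forall>c. \<forall>x\<in>W. f (s c x) = s c (f x))}"

definition hom_scale ::
    "(complex \<Rightarrow> 'v::ab_group_add \<Rightarrow> 'v) \<Rightarrow> 'v set \<Rightarrow> complex \<Rightarrow> ('v \<Rightarrow> 'v) \<Rightarrow> ('v \<Rightarrow> 'v)" where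
  "hom_scale s W c f = (\<lambda>x\<in>W. s c (f x))"

subsection \<open>The set \<open>M\<close> and its projectivization\<close>

primrec Vsp :: "('v::ab_group_add \<Rightarrow> 'v) list \<Rightarrow> nat \<Rightarrow> 'v set" where
  "Vsp As 0 = UNIV"
| "Vsp As (Suc i) = {x \<in> Vsp As i. (As ! i) x = 0}"

definition M :: "(complex \<Rightarrow> 'v::ab_group_add \<Rightarrow> 'v) \<Rightarrow> ('v \<Rightarrow> 'v) list set" where
  "M s = {As. As \<noteq> []
     \<and> (\<forall>i<length As. As ! i \<in> Hom s (Vsp As i) \<and> As ! i \<noteq> (\<lambda>x\<in>Vsp As i. 0))
     \<and> Vsp As (length As) = {0}}"

definition projM ::
    "(complex \<Rightarrow> 'v::ab_group_add \<Rightarrow> 'v) \<Rightarrow> ('v \<Rightarrow> 'v) list \<Rightarrow> ('v \<Rightarrow> 'v) set list" where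
  "projM s As = map (\<lambda>i. pclass (hom_scale s (Vsp As i)) (As ! i)) [0..<length As]"

definition PM :: "(complex \<Rightarrow> 'v::ab_group_add \<Rightarrow> 'v) \<Rightarrow> ('v \<Rightarrow> 'v) set list set" where
  "PM s = projM s ` M s"

text \<open>The value does not depend on the chosen representatives; see \<open>Phi_projM\<close> below.\<close>

definition Phi ::
    "(complex \<Rightarrow> 'v::ab_group_add \<Rightarrow> 'v) \<Rightarrow> ('v \<Rightarrow> 'v) set list \<Rightarrow> 'v set \<Rightarrow> 'v set" where
  "Phi s p = (\<lambda>X\<in>PV s. THE Y. \<exists>As\<in>M s. \<exists>i<length As. \<exists>x\<in>Vsp As i - Vsp As (Suc i).
      p = projM s As \<and> X = pclass s x \<and> Y = pclass s ((As ! i) x))"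

subsection \<open>The product on \<open>PM\<close>\<close>

definition Ker :: "('v::ab_group_add \<Rightarrow> 'v) \<Rightarrow> 'v set" where
  "Ker f = {x. f x = 0}"

definition Mt' :: "(complex \<Rightarrow> 'v::ab_group_add \<Rightarrow> 'v) \<Rightarrow> ('v \<Rightarrow> 'v) list set" where
  "Mt' s = {As. As \<noteq> [] \<and> (\<forall>A\<in>set As. Vector_Spaces.linear s s A) \<and> (\<Inter>A\<in>set As. Ker A) = {0}}"

text \<open>The entry at position \<open>length As * j + i\<close> is \<open>As ! i \<circ> Bs ! j\<close>.\<close>

definition seq_mult :: "('v \<Rightarrow> 'v) list \<Rightarrow> ('v \<Rightarrow> 'v) list \<Rightarrow> ('v \<Rightarrow> 'v) list" where
  "seq_mult As Bs = concat (map (\<lambda>B. map (\<lambda>A. A \<circ> B) As) Bs)"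

text \<open>The index is shifted by one: \<open>K As i\<close> is the space usually written \<open>K(As)\<close> with
  index \<open>i - 1\<close>, so \<open>K As 0 = UNIV\<close>.\<close>

definition K :: "('v::ab_group_add \<Rightarrow> 'v) list \<Rightarrow> nat \<Rightarrow> 'v set" where
  "K As i = (\<Inter>k<i. Ker (As ! k))"

definition Psi :: "('v::ab_group_add \<Rightarrow> 'v) list \<Rightarrow> ('v \<Rightarrow> 'v) list" where
  "Psi As = nths As {i. K As (Suc i) \<subset> K As i}"

definition Mt :: "(complex \<Rightarrow> 'v::ab_group_add \<Rightarrow> 'v) \<Rightarrow> ('v \<Rightarrow> 'v) list set" where
  "Mt s = {As \<in> Mt' s. \<forall>i<length As. K As (Suc i) \<subset> K As i}"

definition restr :: "('v::ab_group_add \<Rightarrow> 'v) list \<Rightarrow> ('v \<Rightarrow> 'v) list" where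
  \<comment> \<open>the map \<open>\<pi>\<close> from \<open>Mt\<close> to \<open>M\<close>\<close>
  "restr As = map (\<lambda>i. restrict (As ! i) (K As i)) [0..<length As]"

text \<open>The value does not depend on the chosen representatives; see \<open>PM_mult_projM\<close> below.\<close>

definition PM_mult :: "(complex \<Rightarrow> 'v::ab_group_add \<Rightarrow> 'v) \<Rightarrow>
    ('v \<Rightarrow> 'v) set list \<Rightarrow> ('v \<Rightarrow> 'v) set list \<Rightarrow> ('v \<Rightarrow> 'v) set list" where
  "PM_mult s p q = (THE r. \<exists>As\<in>Mt s. \<exists>Bs\<in>Mt s.
      p = projM s (restr As) \<and> q = projM s (restr Bs) \<and> r = projM s (restr (Psi (seq_mult As Bs))))"

definition PM_monoid ::
    "(complex \<Rightarrow> 'v::ab_group_add \<Rightarrow> 'v) \<Rightarrow> ('v \<Rightarrow> 'v) set list monoid" where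
  "PM_monoid s = \<lparr>carrier = PM s, mult = PM_mult s, one = [pclass (hom_scale s UNIV) id]\<rparr>"

subsection \<open>The monoid of self-maps and monoid actions\<close>

definition Map_monoid :: "'a set \<Rightarrow> ('a \<Rightarrow> 'a) monoid" where
  "Map_monoid S = \<lparr>carrier = S \<rightarrow>\<^sub>E S, mult = compose S, one = (\<lambda>x\<in>S. x)\<rparr>"

definition monoid_acts :: "('m, 'r) monoid_scheme \<Rightarrow> 'a set \<Rightarrow> ('m \<Rightarrow> 'a \<Rightarrow> 'a) \<Rightarrow> bool" where
  "monoid_acts G S act \<longleftrightarrow> Group.monoid G
     \<and> (\<forall>g\<in>carrier G. \<forall>x\<in>S. act g x \<in> S)
     \<and> (\<forall>x\<in>S. act \<one>\<^bsub>G\<^esub> x = x)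
     \<and> (\<forall>g\<in>carrier G. \<forall>h\<in>carrier G. \<forall>x\<in>S. act (g \<otimes>\<^bsub>G\<^esub> h) x = act g (act h x))"

subsection \<open>Independence of representatives\<close>

lemma Vsp_eq_K: "Vsp As i = K As i"
  by (induction i) (auto simp: K_def Ker_def less_Suc_eq)

lemma Vsp_append: "i \<le> length As \<Longrightarrow> Vsp (As @ Bs) i = Vsp As i"
  by (auto simp: Vsp_eq_K K_def nth_append)

definition KA :: "('v::ab_group_add \<Rightarrow> 'v) list \<Rightarrow> 'v set" where
  "KA As = (\<Inter>A\<in>set As. Ker A)"

lemma Vsp_length: "Vsp As (length As) = KA As"
  by (auto simp: Vsp_eq_K K_def KA_def set_conv_nth)

lemma pclass_eqI:
  assumes "c \<noteq> 0" and g: "\<And>d. sc d g = sc (d * c) f" and f: "\<And>d. sc d f = sc (d / c) g"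
  shows "pclass sc f = pclass sc g"
proof (intro subset_antisym subsetI)
  fix y assume "y \<in> pclass sc f"
  then obtain d where "d \<noteq> 0" "y = sc d f" by (auto simp: pclass_def)
  then have "d / c \<noteq> 0 \<and> y = sc (d / c) g" using assms(1) f[of d] by simp
  then show "y \<in> pclass sc g" unfolding pclass_def by blast
next
  fix y assume "y \<in> pclass sc g"
  then obtain d where "d \<noteq> 0" "y = sc d g" by (auto simp: pclass_def)
  then have "d * c \<noteq> 0 \<and> y = sc (d * c) f" using assms(1) g[of d] by simp
  then show "y \<in> pclass sc f" unfolding pclass_def by blast
qed

lemma pclass_hom_eq:
  assumes "vector_space s"
  shows "pclass (hom_scale s W) f = pclass (hom_scale s W) g
    \<longleftrightarrow> (\<exists>c. c \<noteq> 0 \<and> (\<forall>x\<in>W. g x = s c (f x)))"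
proof -
  interpret vector_space s by fact
  show ?thesis
  proof
    assume eq: "pclass (hom_scale s W) f = pclass (hom_scale s W) g"
    have "hom_scale s W 1 g \<in> pclass (hom_scale s W) g"
      unfolding pclass_def by (intro CollectI exI[of _ 1]) simp
    then obtain c where c: "c \<noteq> 0" "hom_scale s W 1 g = hom_scale s W c f"
      unfolding eq[symmetric] by (auto simp: pclass_def)
    have "g x = s c (f x)" if "x \<in> W" for x
      using fun_cong[OF c(2), of x] that by (simp add: hom_scale_def)
    with c(1) show "\<exists>c. c \<noteq> 0 \<and> (\<forall>x\<in>W. g x = s c (f x))" by blast
  next
    assume "\<exists>c. c \<noteq> 0 \<and> (\<forall>x\<in>W. g x = s c (f x))"
    then obtain c where c: "c \<noteq> 0" "\<forall>x\<in>W. g x = s c (f x)" by blast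
    have g: "hom_scale s W d g = hom_scale s W (d * c) f" for d
      unfolding hom_scale_def by (intro restrict_ext) (simp add: c)
    have f: "hom_scale s W d f = hom_scale s W (d / c) g" for d
      unfolding hom_scale_def by (intro restrict_ext) (simp add: c)
    show "pclass (hom_scale s W) f = pclass (hom_scale s W) g"
      by (rule pclass_eqI[of c "hom_scale s W" g f, OF c(1) g f])
  qed
qed

definition hc :: "(complex \<Rightarrow> 'v::ab_group_add \<Rightarrow> 'v) \<Rightarrow> 'v set \<Rightarrow> ('v \<Rightarrow> 'v) list
    \<Rightarrow> ('v \<Rightarrow> 'v) set list" where
  "hc s W As = map (\<lambda>i. pclass (hom_scale s (W \<inter> Vsp As i)) (As ! i)) [0..<length As]"

lemma hc_Nil [simp]: "hc s W [] = []"
  by (simp add: hc_def)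

lemma projM_hc: "projM s As = hc s UNIV As"
  by (simp add: projM_def hc_def)

lemma length_hc [simp]: "length (hc s W As) = length As"
  by (simp add: hc_def)

lemma hc_snoc: "hc s W (As @ [A]) = hc s W As @ [pclass (hom_scale s (W \<inter> KA As)) A]"
  by (auto simp: hc_def Vsp_append Vsp_length nth_append)

lemma KA_append: "KA (As @ Bs) = KA As \<inter> KA Bs"
  by (auto simp: KA_def)

lemma hc_append: "hc s W (As @ Bs) = hc s W As @ hc s (W \<inter> KA As) Bs"
proof (induction Bs rule: rev_induct)
  case (snoc B Bs)
  then show ?case
    using hc_snoc[of s W "As @ Bs" B] by (simp add: hc_snoc KA_append Int_assoc)
qed simp

lemma hc_eq_KA:
  assumes "vector_space s" "hc s W As = hc s W Bs"
  shows "W \<inter> KA As = W \<inter> KA Bs"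
  using assms(2)
proof (induction As arbitrary: Bs rule: rev_induct)
  case Nil
  then show ?case by (simp add: hc_def)
next
  case (snoc A As)
  interpret vector_space s by fact
  have "length Bs = Suc (length As)" using snoc.prems by (metis length_hc length_append_singleton)
  then obtain Cs B where Bs: "Bs = Cs @ [B]" by (metis length_Suc_conv_rev)
  have 1: "hc s W As = hc s W Cs"
    and 2: "pclass (hom_scale s (W \<inter> KA As)) A = pclass (hom_scale s (W \<inter> KA Cs)) B"
    using snoc.prems by (auto simp: Bs hc_snoc)
  have 3: "W \<inter> KA As = W \<inter> KA Cs" using snoc.IH[OF 1] .
  obtain c where c: "c \<noteq> 0" "\<forall>x \<in> W \<inter> KA As. B x = s c (A x)"
    using 2 unfolding 3[symmetric] pclass_hom_eq[OF assms(1)] by blast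
  have "A x = 0 \<longleftrightarrow> B x = 0" if "x \<in> W \<inter> KA As" for x
    using c that by auto
  then show ?case using 3 by (auto simp: Bs KA_def Ker_def)
qed

lemma hc_eq_snocE:
  assumes "vector_space s" "hc s W (As @ [A]) = hc s W Bs"
  obtains Cs B c where "Bs = Cs @ [B]" "hc s W As = hc s W Cs" "W \<inter> KA As = W \<inter> KA Cs"
    "c \<noteq> 0" "\<forall>x \<in> W \<inter> KA As. B x = s c (A x)"
proof -
  have "length Bs = Suc (length As)" using assms(2) by (metis length_hc length_append_singleton)
  then obtain Cs B where Bs: "Bs = Cs @ [B]" by (metis length_Suc_conv_rev)
  have 1: "hc s W As = hc s W Cs"
    and 2: "pclass (hom_scale s (W \<inter> KA As)) A = pclass (hom_scale s (W \<inter> KA Cs)) B"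
    using assms(2) by (auto simp: Bs hc_snoc)
  have 3: "W \<inter> KA As = W \<inter> KA Cs" using hc_eq_KA[OF assms(1) 1] .
  obtain c where "c \<noteq> 0" "\<forall>x \<in> W \<inter> KA As. B x = s c (A x)"
    using 2 unfolding 3[symmetric] pclass_hom_eq[OF assms(1)] by blast
  with Bs 1 3 that show ?thesis by blast
qed

lemma Psi_Nil [simp]: "Psi [] = []"
  by (simp add: Psi_def)

lemma Psi_snoc: "Psi (As @ [A]) = Psi As @ (if KA As \<inter> Ker A \<subset> KA As then [A] else [])"
proof -
  have K1: "K (As @ [A]) i = K As i" if "i \<le> length As" for i
    using that by (auto simp: K_def nth_append)
  have K2: "K (As @ [A]) (length As) = KA As"
    using K1[of "length As"] Vsp_length[of As] by (simp add: Vsp_eq_K)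
  have K3: "K (As @ [A]) (Suc (length As)) = KA As \<inter> Ker A"
    using Vsp_length[of "As @ [A]"] by (simp add: Vsp_eq_K KA_def Int_commute)
  have "nths As {i. K (As @ [A]) (Suc i) \<subset> K (As @ [A]) i} = nths As {i. K As (Suc i) \<subset> K As i}"
    unfolding nths_def by (rule arg_cong[where f = "map fst"], rule filter_cong)
      (auto simp: K1 set_zip)
  then show ?thesis
    by (simp add: Psi_def nths_append K2 K3)
qed

lemma KA_Psi: "KA (Psi As) = KA As"
proof (induction As rule: rev_induct)
  case (snoc A As)
  then show ?case by (auto simp: Psi_snoc KA_append) (auto simp: KA_def)
qed simp

lemma Psi_cong:
  assumes "vector_space s" "projM s As = projM s Bs"
  shows "projM s (Psi As) = projM s (Psi Bs)"
  using assms(2) unfolding projM_hc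
proof (induction As arbitrary: Bs rule: rev_induct)
  case Nil
  then show ?case by (simp add: hc_def)
next
  case (snoc A As)
  interpret vector_space s by fact
  obtain Cs B c where Bs: "Bs = Cs @ [B]" and 1: "hc s UNIV As = hc s UNIV Cs"
    and 2: "KA As = KA Cs" and c: "c \<noteq> 0" "\<forall>x \<in> KA As. B x = s c (A x)"
    using hc_eq_snocE[OF assms(1) snoc.prems] by auto
  have 3: "KA As \<inter> Ker A = KA Cs \<inter> Ker B"
    using c unfolding 2 by (auto simp: Ker_def)
  have 4: "pclass (hom_scale s (KA As)) A = pclass (hom_scale s (KA As)) B"
    unfolding pclass_hom_eq[OF assms(1)] using c by blast
  show ?case
    using snoc.IH[OF 1] 2 3 4 by (simp add: Bs Psi_snoc hc_snoc KA_Psi)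
qed

lemma KA_comp: "KA (map (\<lambda>A. A \<circ> B) As) = {x. B x \<in> KA As}"
  by (auto simp: KA_def Ker_def)

lemma hc_comp_cong:
  assumes "vector_space s" "hc s UNIV As = hc s UNIV As'"
    and "\<forall>A\<in>set As. Vector_Spaces.linear s s A" "\<forall>A\<in>set As'. Vector_Spaces.linear s s A"
    and d: "d \<noteq> 0" "\<forall>x\<in>W. B' x = s d (B x)"
  shows "hc s W (map (\<lambda>A. A \<circ> B) As) = hc s W (map (\<lambda>A. A \<circ> B') As')"
  using assms(2-4)
proof (induction As arbitrary: As' rule: rev_induct)
  case Nil
  then show ?case by (simp add: hc_def)
next
  case (snoc A As)
  interpret vector_space s by fact
  obtain Cs A' c where As': "As' = Cs @ [A']" and 1: "hc s UNIV As = hc s UNIV Cs"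
    and 2: "KA As = KA Cs" and c: "c \<noteq> 0" "\<forall>x \<in> KA As. A' x = s c (A x)"
    using hc_eq_snocE[OF assms(1) snoc.prems(1)] by auto
  let ?X = "map (\<lambda>A. A \<circ> B) As" and ?Y = "map (\<lambda>A. A \<circ> B') Cs"
  have 3: "hc s W ?X = hc s W ?Y"
    by (rule snoc.IH[OF 1]) (use snoc.prems As' in auto)
  have 4: "W \<inter> KA ?X = W \<inter> KA ?Y" using hc_eq_KA[OF assms(1) 3] .
  have lin: "Vector_Spaces.linear s s A'" using snoc.prems As' by auto
  have "(A' \<circ> B') x = s (c * d) ((A \<circ> B) x)" if "x \<in> W \<inter> KA ?X" for x
  proof -
    have "B x \<in> KA As" "B' x = s d (B x)" using that d by (auto simp: KA_comp)
    moreover have "A' (s d (B x)) = s d (A' (B x))"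
      using lin by (simp add: Vector_Spaces.linear_iff)
    ultimately show ?thesis using c by (simp add: mult.commute)
  qed
  then have "pclass (hom_scale s (W \<inter> KA ?X)) (A \<circ> B) = pclass (hom_scale s (W \<inter> KA ?X)) (A' \<circ> B')"
    unfolding pclass_hom_eq[OF assms(1)] using c d by (metis mult_eq_0_iff)
  then show ?case using 3 4 unfolding As' map_append list.map hc_snoc by simp
qed

lemma seq_mult_snoc: "seq_mult As (Bs @ [B]) = seq_mult As Bs @ map (\<lambda>A. A \<circ> B) As"
  by (simp add: seq_mult_def)

lemma KA_seq_mult: "KA As = {0} \<Longrightarrow> KA (seq_mult As Bs) = KA Bs"
proof (induction Bs rule: rev_induct)
  case (snoc B Bs)
  then show ?case by (simp add: seq_mult_snoc KA_append KA_comp) (auto simp: KA_def Ker_def)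
qed (simp add: seq_mult_def KA_def)

lemma seq_mult_cong:
  assumes "vector_space s" "As \<in> Mt' s" "As' \<in> Mt' s"
    and "projM s As = projM s As'" "projM s Bs = projM s Bs'"
  shows "projM s (seq_mult As Bs) = projM s (seq_mult As' Bs')"
  using assms(5) unfolding projM_hc
proof (induction Bs arbitrary: Bs' rule: rev_induct)
  case Nil
  then show ?case by (simp add: hc_def seq_mult_def)
next
  case (snoc B Bs)
  obtain Cs B' c where Bs': "Bs' = Cs @ [B']" and 1: "hc s UNIV Bs = hc s UNIV Cs"
    and 2: "KA Bs = KA Cs" and c: "c \<noteq> 0" "\<forall>x \<in> KA Bs. B' x = s c (B x)"
    using hc_eq_snocE[OF assms(1) snoc.prems] by auto
  have K: "KA As = {0}" "KA As' = {0}" using assms(2,3) by (auto simp: Mt'_def KA_def)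
  have "hc s (KA Bs) (map (\<lambda>A. A \<circ> B) As) = hc s (KA Bs) (map (\<lambda>A. A \<circ> B') As')"
    by (rule hc_comp_cong[OF assms(1) _ _ _ c]) (use assms in \<open>auto simp: Mt'_def projM_hc\<close>)
  then show ?case
    using snoc.IH[OF 1] by (simp add: Bs' seq_mult_snoc hc_append KA_seq_mult K 2)
qed

lemma projM_restr: "projM s (restr As) = projM s As"
proof -
  have nth: "(restr As ! i) x = (As ! i) x" if "i < length As" "x \<in> Vsp As i" for i x
    using that by (simp add: restr_def Vsp_eq_K)
  have K: "Vsp (restr As) i = Vsp As i" if "i \<le> length As" for i
    using that by (induction i) (auto simp: nth)
  have "hom_scale s (Vsp As i) c (restr As ! i) = hom_scale s (Vsp As i) c (As ! i)"
    if "i < length As" for i c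
    using that by (auto simp: hom_scale_def nth)
  then show ?thesis
    by (simp add: projM_def K pclass_def restr_def[THEN arg_cong[where f = length]])
qed

theorem PM_mult_projM:
  assumes "vector_space s" "As \<in> Mt s" "Bs \<in> Mt s"
  shows "PM_mult s (projM s (restr As)) (projM s (restr Bs))
    = projM s (restr (Psi (seq_mult As Bs)))"
  unfolding PM_mult_def projM_restr
  by (rule the_equality)
    (use assms in \<open>auto intro!: Psi_cong seq_mult_cong simp: Mt_def\<close>)

lemma Vsp_antimono: "i \<le> j \<Longrightarrow> Vsp As j \<subseteq> Vsp As i"
  by (auto simp: Vsp_eq_K K_def)

lemma projM_eqD:
  assumes "vector_space s" "projM s As = projM s Bs"
  shows "length As = length Bs"
    and "i \<le> length As \<Longrightarrow> Vsp As i = Vsp Bs i"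
    and "i < length As \<Longrightarrow> \<exists>c. c \<noteq> 0 \<and> (\<forall>x\<in>Vsp As i. (Bs ! i) x = s c ((As ! i) x))"
proof -
  interpret vector_space s by fact
  show len: "length As = length Bs" using assms(2) by (metis projM_hc length_hc)
  have nth: "pclass (hom_scale s (Vsp As i)) (As ! i) = pclass (hom_scale s (Vsp Bs i)) (Bs ! i)"
    if "i < length As" for i
    using arg_cong[OF assms(2), of "\<lambda>l. l ! i"] that len by (simp add: projM_def)
  show V: "i \<le> length As \<Longrightarrow> Vsp As i = Vsp Bs i" for i
  proof (induction i)
    case (Suc i)
    then have eq: "Vsp As i = Vsp Bs i" by simp
    have "i < length As" using Suc.prems by simp
    from nth[OF this] obtain c where "c \<noteq> 0" "\<forall>x\<in>Vsp As i. (Bs ! i) x = s c ((As ! i) x)"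
      unfolding eq[symmetric] pclass_hom_eq[OF assms(1)] by blast
    then show ?case using eq by auto
  qed simp
  show "i < length As \<Longrightarrow> \<exists>c. c \<noteq> 0 \<and> (\<forall>x\<in>Vsp As i. (Bs ! i) x = s c ((As ! i) x))"
    using nth[of i] unfolding V[of i, symmetric, OF less_imp_le] pclass_hom_eq[OF assms(1)]
    by (simp add: V[of i, symmetric, OF less_imp_le] pclass_hom_eq[OF assms(1)])
qed

lemma pclass_eq:
  assumes "vector_space s"
  shows "pclass s x = pclass s y \<longleftrightarrow> (\<exists>c. c \<noteq> 0 \<and> y = s c x)"
proof -
  interpret vector_space s by fact
  show ?thesis
  proof
    assume "pclass s x = pclass s y"
    moreover have "y \<in> pclass s y" unfolding pclass_def by (intro CollectI exI[of _ 1]) simp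
    ultimately show "\<exists>c. c \<noteq> 0 \<and> y = s c x" by (auto simp: pclass_def)
  next
    assume "\<exists>c. c \<noteq> 0 \<and> y = s c x"
    then obtain c where c: "c \<noteq> 0" "y = s c x" by blast
    show "pclass s x = pclass s y"
      by (rule pclass_eqI[of c s y x, OF c(1)]) (use c in simp_all)
  qed
qed

theorem Phi_projM:
  assumes "vector_space s" "As \<in> M s" "i < length As" "x \<in> Vsp As i - Vsp As (Suc i)"
  shows "Phi s (projM s As) (pclass s x) = pclass s ((As ! i) x)"
proof -
  interpret vector_space s by fact
  have hom: "(Bs ! j) (s c y) = s c ((Bs ! j) y)"
    if "Bs \<in> M s" "j < length Bs" "y \<in> Vsp Bs j" for Bs j c y
    using that by (auto simp: M_def Hom_def)
  have scl: "s c y \<in> Vsp Bs j" if "Bs \<in> M s" "j \<le> length Bs" "y \<in> Vsp Bs j" for Bs j c y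
    using that(2,3)
  proof (induction j)
    case (Suc j)
    then show ?case using hom[OF that(1), of j y c] by simp
  qed simp
  have "x \<noteq> 0"
  proof
    assume "x = 0"
    then have "x \<in> Vsp As (length As)" using assms(2) by (simp add: M_def)
    moreover have "Vsp As (length As) \<subseteq> Vsp As (Suc i)"
      using assms(3) by (intro Vsp_antimono) simp
    ultimately show False using assms(4) by blast
  qed
  then have X: "pclass s x \<in> PV s" by (auto simp: PV_def)
  have uniq: "pclass s ((Bs ! j) y) = pclass s ((As ! i) x)"
    if B: "Bs \<in> M s" "j < length Bs" "y \<in> Vsp Bs j - Vsp Bs (Suc j)"
      and eq: "projM s As = projM s Bs" "pclass s x = pclass s y" for Bs j y
  proof -
    note D = projM_eqD[OF assms(1) eq(1)]
    obtain d where d: "d \<noteq> 0" "y = s d x" using pclass_eq[OF assms(1), THEN iffD1, OF eq(2)] by blast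
    have x: "x = s (1 / d) y" using d by simp
    have jA: "j < length As" using B D(1) by simp
    have yA: "y \<in> Vsp As j" "y \<notin> Vsp As (Suc j)"
      using B(3) D(2)[of j] D(2)[of "Suc j"] jA by simp_all
    have xj: "x \<in> Vsp As j"
      using scl[OF assms(2) _ yA(1), of "1 / d"] jA x by simp
    have xSj: "x \<notin> Vsp As (Suc j)"
      using scl[OF assms(2), of "Suc j" x d] jA d(2) yA(2) by auto
    have "j = i"
    proof (rule ccontr)
      assume "j \<noteq> i"
      then consider "Suc j \<le> i" | "Suc i \<le> j" by linarith
      then show False
      proof cases
        case 1
        then show ?thesis using Vsp_antimono[OF 1, of As] assms(4) xSj by blast
      next
        case 2
        then show ?thesis using Vsp_antimono[OF 2, of As] assms(4) xj by blast
      qed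
    qed
    obtain c where c: "c \<noteq> 0" "\<forall>x\<in>Vsp As i. (Bs ! i) x = s c ((As ! i) x)"
      using D(3)[OF assms(3)] by blast
    have "(Bs ! j) y = s c ((As ! i) (s d x))" using c(2) yA(1) \<open>j = i\<close> d(2) by metis
    also have "\<dots> = s (c * d) ((As ! i) x)" using hom[OF assms(2,3)] assms(4) by simp
    finally have "(Bs ! j) y = s (c * d) ((As ! i) x)" .
    moreover have "c * d \<noteq> 0" using c(1) d(1) by simp
    ultimately have "pclass s ((As ! i) x) = pclass s ((Bs ! j) y)"
      using pclass_eq[OF assms(1), THEN iffD2] by blast
    then show ?thesis by simp
  qed
  show ?thesis
    unfolding Phi_def restrict_apply'[OF X]
  proof (rule the_equality)
    show "\<exists>Bs\<in>M s. \<exists>j<length Bs. \<exists>y\<in>Vsp Bs j - Vsp Bs (Suc j).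
      projM s As = projM s Bs \<and> pclass s x = pclass s y
      \<and> pclass s ((As ! i) x) = pclass s ((Bs ! j) y)"
      by (intro bexI[OF _ assms(2)] exI[of _ i] conjI assms(3) bexI[OF _ assms(4)] refl)
  next
    fix Y assume "\<exists>Bs\<in>M s. \<exists>j<length Bs. \<exists>y\<in>Vsp Bs j - Vsp Bs (Suc j).
      projM s As = projM s Bs \<and> pclass s x = pclass s y \<and> Y = pclass s ((Bs ! j) y)"
    then show "Y = pclass s ((As ! i) x)"
      using uniq by (elim bexE exE conjE) simp
  qed
qed

end

theory Submission
  imports Defs
begin

text \<open>A sequence \<open>As\<close> of endomorphisms with trivial common kernel acts on nonzero vectors by
  \<open>x \<mapsto> A x\<close> for the first entry \<open>A\<close> of \<open>As\<close> not killing \<open>x\<close>. This action is unchanged by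
  \<open>Psi\<close> and turns \<open>seq_mult\<close> into composition. Moreover \<open>Psi\<close> may be applied to either factor
  of a product before taking \<open>Psi\<close> of the product without changing the result, as lists, so that
  \<open>Mt\<close> is already a monoid; \<open>PM\<close> is a quotient of it because each entry of an element of \<open>M\<close>
  extends to a linear endomorphism of \<open>V\<close>.\<close>

subsection \<open>Evaluating sequences at vectors\<close>

text \<open>The value 0 stands for the case that no entry is nonzero at \<open>x\<close>; thus it
  occurs exactly on the common kernel of the list.\<close>

primrec first_nonzero :: "('v \<Rightarrow> 'w::zero) list \<Rightarrow> 'v \<Rightarrow> 'w" where
  "first_nonzero [] x = 0"
| "first_nonzero (A # As) x = (if A x \<noteq> 0 then A x else first_nonzero As x)"

lemma first_nonzero_append:
  "first_nonzero (As @ Bs) x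
    = (if first_nonzero As x \<noteq> 0 then first_nonzero As x else first_nonzero Bs x)"
  by (induction As) auto

lemma first_nonzero_eq_0_iff: "first_nonzero As x = 0 \<longleftrightarrow> x \<in> KA As"
  by (induction As) (auto simp: KA_def Ker_def)

text \<open>An entry dropped by \<open>Psi\<close> vanishes wherever all earlier entries vanish, so
  it is never the first nonzero one.\<close>

lemma first_nonzero_Psi: "first_nonzero (Psi As) x = first_nonzero As x"
proof (induction As rule: rev_induct)
  case (snoc A As)
  show ?case
  proof (cases "KA As \<inter> Ker A \<subset> KA As")
    case False
    then have "KA As \<subseteq> Ker A" by blast
    then have "first_nonzero As x = 0 \<Longrightarrow> A x = 0"
      by (auto simp: first_nonzero_eq_0_iff Ker_def)
    with False snoc.IH show ?thesis by (auto simp: Psi_snoc first_nonzero_append)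
  qed (simp add: Psi_snoc first_nonzero_append snoc.IH)
qed simp

lemma first_nonzero_comp:
  "first_nonzero (map (\<lambda>A. A \<circ> B) As) x = first_nonzero As (B x)"
  by (induction As) auto

text \<open>The product has one block for each \<open>B\<close>, with value
  \<open>first_nonzero As (B x)\<close>. Since \<open>KA As = {0}\<close>, this is nonzero exactly
  when \<open>B x\<close> is, so the block that decides is that of the first \<open>B\<close> not
  killing \<open>x\<close>.\<close>

lemma first_nonzero_seq_mult:
  assumes "KA As = {0}"
  shows "first_nonzero (seq_mult As Bs) x = first_nonzero As (first_nonzero Bs x)"
proof (induction Bs)
  case Nil
  then show ?case
    using assms by (simp add: seq_mult_def first_nonzero_eq_0_iff eq_commute[of 0])
next
  case (Cons B Bs)
  have "first_nonzero As y = 0 \<longleftrightarrow> y = 0" for y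
    using assms by (simp add: first_nonzero_eq_0_iff)
  with Cons show ?case
    by (simp add: seq_mult_def first_nonzero_append first_nonzero_comp)
qed

lemma first_nonzero_nth:
  assumes "i < length As" "x \<in> Vsp As i" "x \<notin> Vsp As (Suc i)"
  shows "first_nonzero As x = (As ! i) x"
proof -
  have "first_nonzero (take i As) x = 0"
    using assms(1,2) by (auto simp: first_nonzero_eq_0_iff KA_def Vsp_eq_K K_def set_conv_nth)
  moreover have "As = take i As @ As ! i # drop (Suc i) As"
    using assms(1) by (simp add: id_take_nth_drop)
  moreover have "(As ! i) x \<noteq> 0" using assms(2,3) by simp
  ultimately show ?thesis by (metis first_nonzero_append first_nonzero.simps(2))
qed

subsection \<open>The monoid \<open>Mt\<close>\<close>

text \<open>\<open>Psi\<close> of a concatenation must filter the second list against the kernel of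
  the first. Here \<open>W\<close> carries the space left over by the entries already read, so that
  the filter splits along concatenations.\<close>

fun rel_Psi :: "'v::ab_group_add set \<Rightarrow> ('v \<Rightarrow> 'v) list \<Rightarrow> ('v \<Rightarrow> 'v) list" where
  "rel_Psi W [] = []"
| "rel_Psi W (A # As) = (if W \<subseteq> Ker A then rel_Psi W As else A # rel_Psi (W \<inter> Ker A) As)"

lemma KA_Nil [simp]: "KA [] = UNIV"
  by (simp add: KA_def)

lemma KA_Cons [simp]: "KA (A # As) = Ker A \<inter> KA As"
  by (simp add: KA_def)

lemma rel_Psi_append: "rel_Psi W (As @ Bs) = rel_Psi W As @ rel_Psi (W \<inter> KA As) Bs"
proof (induction As arbitrary: W)
  case (Cons A As)
  have "W \<inter> (Ker A \<inter> KA As) = W \<inter> KA As" if "W \<subseteq> Ker A" using that by blast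
  with Cons show ?case by (simp add: Int_assoc)
qed simp

lemma Psi_eq_rel_Psi: "Psi As = rel_Psi UNIV As"
  by (induction As rule: rev_induct) (auto simp: Psi_snoc rel_Psi_append)

lemma Psi_append: "Psi (As @ Bs) = Psi As @ rel_Psi (KA As) Bs"
  by (simp add: Psi_eq_rel_Psi rel_Psi_append)

text \<open>If \<open>A\<close> vanishes on the kernel of its predecessors, then
  \<open>A \<circ> B\<close> vanishes on the preimage of that kernel under \<open>B\<close>, which
  is the kernel of the composed predecessors. So whatever \<open>Psi\<close> drops would be dropped
  after composition too.\<close>

lemma rel_Psi_comp_Psi:
  "rel_Psi W (map (\<lambda>A. A \<circ> B) (Psi As)) = rel_Psi W (map (\<lambda>A. A \<circ> B) As)"
proof (induction As rule: rev_induct)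
  case (snoc A As)
  let ?L = "map (\<lambda>A. A \<circ> B)"
  show ?case
  proof (cases "KA As \<inter> Ker A \<subset> KA As")
    case True
    have "KA (?L (Psi As)) = KA (?L As)" by (simp only: KA_comp KA_Psi)
    with True snoc show ?thesis by (simp only: Psi_snoc if_True map_append rel_Psi_append list.map)
  next
    case False
    then have "KA As \<subseteq> Ker A" by blast
    then have "W \<inter> KA (?L As) \<subseteq> Ker (A \<circ> B)"
      unfolding KA_comp by (auto simp: Ker_def)
    with False snoc show ?thesis
      by (simp only: Psi_snoc if_False append_Nil2 map_append rel_Psi_append list.map
          rel_Psi.simps if_True)
  qed
qed simp

text \<open>The blocks before that of \<open>B\<close> have common kernel \<open>KA Bs\<close> in
  both products, so the block of \<open>B\<close> is filtered relative to the same space and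
  \<open>rel_Psi_comp_Psi\<close> applies to it.\<close>

lemma Psi_seq_mult_Psi_left:
  assumes "KA As = {0}"
  shows "Psi (seq_mult (Psi As) Bs) = Psi (seq_mult As Bs)"
proof (induction Bs rule: rev_induct)
  case (snoc B Bs)
  then show ?case
    using assms by (simp add: seq_mult_snoc Psi_append KA_seq_mult KA_Psi rel_Psi_comp_Psi)
qed (simp add: seq_mult_def)

lemma rel_Psi_eq_Nil: "W \<subseteq> KA As \<Longrightarrow> rel_Psi W As = []"
  by (induction As) auto

text \<open>If \<open>Psi\<close> drops \<open>B\<close>, then \<open>B\<close> vanishes on
  \<open>KA Bs\<close>. There each \<open>A \<circ> B\<close> takes the value \<open>A 0\<close>,
  which is 0 because 0 lies in \<open>KA As\<close>; so the whole block of \<open>B\<close> is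
  dropped.\<close>

lemma Psi_seq_mult_Psi_right:
  assumes "KA As = {0}"
  shows "Psi (seq_mult As (Psi Bs)) = Psi (seq_mult As Bs)"
proof (induction Bs rule: rev_induct)
  case (snoc B Bs)
  have "rel_Psi (KA Bs) (map (\<lambda>A. A \<circ> B) As) = []" if "KA Bs \<subseteq> Ker B"
    by (rule rel_Psi_eq_Nil) (use that assms in \<open>auto simp: KA_comp Ker_def\<close>)
  with snoc show ?case
    using assms by (auto simp: Psi_snoc seq_mult_snoc Psi_append KA_seq_mult KA_Psi)
qed simp

text \<open>Both sides list the triple composites in the same order: the index in \<open>As\<close>
  runs fastest, that in \<open>Cs\<close> slowest.\<close>

lemma seq_mult_assoc: "seq_mult (seq_mult As Bs) Cs = seq_mult As (seq_mult Bs Cs)"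
proof (induction Cs)
  case (Cons C Cs)
  have "map (\<lambda>A. A \<circ> C) (seq_mult As Bs) = seq_mult As (map (\<lambda>B. B \<circ> C) Bs)"
    by (simp add: seq_mult_def map_concat comp_def)
  with Cons show ?case by (simp add: seq_mult_def)
qed (simp add: seq_mult_def)

lemma seq_mult_id_left: "seq_mult [id] As = As"
  by (simp add: seq_mult_def)

lemma seq_mult_id_right: "seq_mult As [id] = As"
  by (simp add: seq_mult_def)

section \<open>Fixed points of \<open>Psi\<close> and the product on \<open>Mt\<close>\<close>

lemma Psi_Psi: "Psi (Psi As) = Psi As"
  using rel_Psi_comp_Psi[of UNIV id As] by (simp add: Psi_eq_rel_Psi)

lemma length_rel_Psi: "length (rel_Psi W As) \<le> length As"
  by (induction W As rule: rel_Psi.induct) auto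

lemma Psi_eq_iff: "Psi As = As \<longleftrightarrow> (\<forall>i<length As. K As (Suc i) \<subset> K As i)"
proof (induction As rule: rev_induct)
  case (snoc A As)
  have 1: "K (As @ [A]) i = K As i" if "i \<le> length As" for i
    using Vsp_append[OF that] by (simp add: Vsp_eq_K)
  have 2: "K As (length As) = KA As" "K (As @ [A]) (Suc (length As)) = KA As \<inter> Ker A"
    using Vsp_length[of As] Vsp_length[of "As @ [A]"]
    by (simp_all add: Vsp_eq_K KA_append)
  have 3: "length (Psi As) \<le> length As"
    by (simp add: Psi_eq_rel_Psi length_rel_Psi)
  \<comment> \<open>If the last entry were dropped, \<open>Psi As\<close> would have to be longer
    than \<open>As\<close>, against 3.\<close>
  have "Psi (As @ [A]) = As @ [A] \<longleftrightarrow> Psi As = As \<and> KA As \<inter> Ker A \<subset> KA As"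
    using 3 by (auto simp: Psi_snoc dest: arg_cong[where f = length])
  also have "\<dots> \<longleftrightarrow> (\<forall>i<Suc (length As). K (As @ [A]) (Suc i) \<subset> K (As @ [A]) i)"
    unfolding snoc.IH less_Suc_eq by (auto simp: 1 2)
  finally show ?case by simp
qed simp

lemma Mt_iff: "As \<in> Mt s \<longleftrightarrow> As \<in> Mt' s \<and> Psi As = As"
  by (simp add: Mt_def Psi_eq_iff)

lemma Psi_Mt: "As \<in> Mt s \<Longrightarrow> Psi As = As"
  by (simp add: Mt_iff)

lemma Mt'_KA: "As \<in> Mt' s \<Longrightarrow> KA As = {0}"
  by (simp add: Mt'_def KA_def)

lemma Mt_KA: "As \<in> Mt s \<Longrightarrow> KA As = {0}"
  unfolding Mt_def by (blast dest: Mt'_KA)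

text \<open>The empty list has kernel \<open>UNIV\<close>, so for nonzero \<open>V\<close> a trivial
  kernel forces the list to be nonempty.\<close>

lemma Mt'I:
  assumes "(UNIV :: 'v::ab_group_add set) \<noteq> {0}" "KA As = {0::'v}"
    and "\<forall>A\<in>set As. Vector_Spaces.linear s s A"
  shows "As \<in> Mt' s"
  using assms by (cases As) (auto simp: Mt'_def KA_def)

lemma Psi_seq_mult_in_Mt:
  fixes s :: "complex \<Rightarrow> 'v::ab_group_add \<Rightarrow> 'v"
  assumes "(UNIV :: 'v set) \<noteq> {0}" "As \<in> Mt' s" "Bs \<in> Mt' s"
  shows "Psi (seq_mult As Bs) \<in> Mt s"
proof -
  have "\<forall>C\<in>set (seq_mult As Bs). Vector_Spaces.linear s s C"
    using assms(2,3) by (auto simp: seq_mult_def Mt'_def intro: Vector_Spaces.linear_compose)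
  moreover have "set (Psi (seq_mult As Bs)) \<subseteq> set (seq_mult As Bs)"
    by (simp add: Psi_def set_nths_subset)
  ultimately have "\<forall>C\<in>set (Psi (seq_mult As Bs)). Vector_Spaces.linear s s C"
    by blast
  then show ?thesis
    using assms by (auto simp: Mt_iff Psi_Psi KA_Psi KA_seq_mult Mt'_KA intro: Mt'I)
qed

text \<open>Both inner occurrences of \<open>Psi\<close> can be removed, the left one because
  \<open>seq_mult As Bs\<close> again has trivial kernel; what remains is
  \<open>seq_mult_assoc\<close>.\<close>

lemma Psi_seq_mult_assoc:
  assumes "As \<in> Mt' s" "Bs \<in> Mt' s"
  shows "Psi (seq_mult (Psi (seq_mult As Bs)) Cs) = Psi (seq_mult As (Psi (seq_mult Bs Cs)))"
  using assms
  by (simp add: Psi_seq_mult_Psi_left Psi_seq_mult_Psi_right KA_seq_mult Mt'_KA seq_mult_assoc)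

lemma id_in_Mt:
  fixes s :: "complex \<Rightarrow> 'v::ab_group_add \<Rightarrow> 'v"
  assumes "vector_space s" "(UNIV :: 'v set) \<noteq> {0}"
  shows "[id] \<in> Mt s"
proof -
  interpret vector_space s by fact
  have "Vector_Spaces.linear s s id" by (rule linear_id)
  then show ?thesis using assms(2) by (auto simp: Mt_iff Mt'_def Psi_eq_rel_Psi Ker_def)
qed

subsection \<open>Lifting \<open>M\<close> to \<open>Mt\<close>\<close>

text \<open>Restricting the entries does not change the chain of kernels, and its strict descent
  makes each restricted entry nonzero.\<close>

lemma restr_in_M:
  assumes "As \<in> Mt s"
  shows "restr As \<in> M s"
proof -
  have len: "length (restr As) = length As" by (simp add: restr_def)
  have V: "Vsp (restr As) i = K As i" if "i \<le> length As" for i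
    using that by (induction i) (auto simp: restr_def K_def Ker_def less_Suc_eq)
  have ne: "As \<noteq> []" and lin: "\<And>A. A \<in> set As \<Longrightarrow> Vector_Spaces.linear s s A"
    and strict: "\<And>i. i < length As \<Longrightarrow> K As (Suc i) \<subset> K As i" and ker: "KA As = {0}"
    using assms by (auto simp: Mt_def Mt'_def KA_def)
  have "restr As ! i \<in> Hom s (Vsp (restr As) i) \<and> restr As ! i \<noteq> (\<lambda>x\<in>Vsp (restr As) i. 0)"
    if i: "i < length As" for i
  proof
    have nth: "restr As ! i = restrict (As ! i) (K As i)" using i by (simp add: restr_def)
    interpret A: Vector_Spaces.linear s s "As ! i" using lin i by simp
    have K: "K As i = {x. \<forall>k<i. (As ! k) x = 0}" by (auto simp: K_def Ker_def)
    have "Vector_Spaces.linear s s (As ! k)" if "k < i" for k using lin that i by simp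
    then have "x + y \<in> K As i" "s c x \<in> K As i" if "x \<in> K As i" "y \<in> K As i" for x y c
      using that by (auto simp: K Vector_Spaces.linear_iff A.vs1.scale_zero_right)
    then show "restr As ! i \<in> Hom s (Vsp (restr As) i)"
      unfolding nth V[OF less_imp_le[OF i]] by (auto simp: Hom_def A.add A.scale)
    obtain x where "x \<in> K As i" "(As ! i) x \<noteq> 0"
      using strict[OF i] by (auto simp: K_def Ker_def lessThan_Suc)
    then show "restr As ! i \<noteq> (\<lambda>x\<in>Vsp (restr As) i. 0)"
      unfolding nth V[OF less_imp_le[OF i]] by (metis restrict_apply')
  qed
  moreover have "Vsp (restr As) (length As) = {0}"
    using V[of "length As"] ker Vsp_length[of As] by (simp add: Vsp_eq_K)
  ultimately show ?thesis using ne len by (auto simp: M_def)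
qed

lemma Hom_extend:
  assumes "vector_space s" "module.subspace s W" "f \<in> Hom s W"
  obtains g where "Vector_Spaces.linear s s g" "\<And>x. x \<in> W \<Longrightarrow> g x = f x"
proof -
  interpret vector_space s by fact
  interpret vector_space_pair s s by unfold_locales
  \<comment> \<open>A left inverse of the identity on \<open>W\<close> is a linear projection onto
    \<open>W\<close>; composing \<open>f\<close> with it extends \<open>f\<close> to
    \<open>V\<close>.\<close>
  obtain P where P: "range P \<subseteq> W" "Vector_Spaces.linear s s P" "\<forall>x\<in>W. P x = x"
    using linear_exists_left_inverse_on[OF linear_id assms(2)] by auto
  interpret P: Vector_Spaces.linear s s P by fact
  have "P x \<in> W" for x using P(1) by blast
  then have "f (P (x + y)) = f (P x) + f (P y)" "f (P (s c x)) = s c (f (P x))" for x y c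
    using assms(3) by (auto simp: P.add P.scale Hom_def)
  then have "Vector_Spaces.linear s s (f \<circ> P)"
    by (simp add: Vector_Spaces.linear_iff vector_space_axioms)
  then show ?thesis using that[of "f \<circ> P"] P(3) by simp
qed

lemma subspace_Vsp:
  assumes "vector_space s" "As \<in> M s" "i \<le> length As"
  shows "module.subspace s (Vsp As i)"
proof -
  interpret vector_space s by fact
  show ?thesis
    using assms(3)
  proof (induction i)
    case (Suc i)
    then have sub: "subspace (Vsp As i)" and "As ! i \<in> Hom s (Vsp As i)"
      using assms(2) by (auto simp: M_def)
    then have hom: "\<And>x y. x \<in> Vsp As i \<Longrightarrow> y \<in> Vsp As i \<Longrightarrow> (As ! i) (x + y) = (As ! i) x + (As ! i) y"
      "\<And>c x. x \<in> Vsp As i \<Longrightarrow> (As ! i) (s c x) = s c ((As ! i) x)"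
      by (auto simp: Hom_def)
    have "(As ! i) 0 = 0" using hom(2)[of 0 0] subspace_0[OF sub] by simp
    then show ?case
      using sub by (auto simp: subspace_def hom)
  qed simp
qed

text \<open>Extending the entries to all of \<open>V\<close> keeps every \<open>Vsp As i\<close>,
  hence both the strict descent and the projective classes.\<close>

lemma projM_lift:
  fixes s :: "complex \<Rightarrow> 'v::ab_group_add \<Rightarrow> 'v"
  assumes "vector_space s" "As \<in> M s"
  obtains Bs where "Bs \<in> Mt s" "projM s As = projM s Bs"
proof -
  have "\<exists>g. Vector_Spaces.linear s s g \<and> (\<forall>x\<in>Vsp As i. g x = (As ! i) x)"
    if "i < length As" for i
  proof -
    have "As ! i \<in> Hom s (Vsp As i)" using assms(2) that by (simp add: M_def)
    with assms(1) subspace_Vsp[OF assms less_imp_le[OF that]] show ?thesis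
      by (rule Hom_extend) blast
  qed
  then obtain g where g: "\<And>i. i < length As \<Longrightarrow> Vector_Spaces.linear s s (g i)"
    "\<And>i x. i < length As \<Longrightarrow> x \<in> Vsp As i \<Longrightarrow> g i x = (As ! i) x"
    by metis
  define Bs where "Bs = map g [0..<length As]"
  have V: "Vsp Bs i = Vsp As i" if "i \<le> length As" for i
    using that by (induction i) (auto simp: Bs_def g(2))
  have "Vsp As (Suc i) \<subset> Vsp As i" if i: "i < length As" for i
  proof -
    have "As ! i \<in> extensional (Vsp As i)" "As ! i \<noteq> (\<lambda>x\<in>Vsp As i. 0)"
      using assms(2) i by (auto simp: M_def Hom_def)
    \<comment> \<open>Extensional functions that agree on \<open>Vsp As i\<close> are equal, so an
      entry other than the zero of \<open>Hom\<close> is nonzero at some vector.\<close>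
    then have "\<exists>x\<in>Vsp As i. (As ! i) x \<noteq> 0"
      by (metis extensionalityI restrict_apply' restrict_extensional)
    then show ?thesis by auto
  qed
  then have "K Bs (Suc i) \<subset> K Bs i" if "i < length Bs" for i
    using that V[of i] V[of "Suc i"] by (simp add: Vsp_eq_K Bs_def)
  moreover have "KA Bs = {0}"
    using V[of "length As"] assms(2) Vsp_length[of Bs] by (simp add: Bs_def M_def)
  ultimately have "Bs \<in> Mt s"
    using assms(2) g(1) by (auto simp: Mt_def Mt'_def KA_def Bs_def M_def)
  moreover have "projM s As = projM s Bs"
  proof -
    have "hom_scale s (Vsp As i) c (As ! i) = hom_scale s (Vsp As i) c (Bs ! i)"
      if "i < length As" for i c
      using that by (auto simp: hom_scale_def Bs_def g(2))
    then show ?thesis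
      by (simp add: projM_def V pclass_def Bs_def[THEN arg_cong[where f = length]])
  qed
  ultimately show ?thesis by (rule that)
qed

section \<open>The product and \<open>Phi\<close> through representatives in
  \<open>Mt\<close>\<close>

lemma PM_eq_Mt:
  assumes "vector_space s"
  shows "PM s = projM s ` Mt s"
proof (intro subset_antisym subsetI)
  fix p assume "p \<in> PM s"
  then show "p \<in> projM s ` Mt s" by (auto simp: PM_def elim: projM_lift[OF assms])
next
  fix p assume "p \<in> projM s ` Mt s"
  then obtain As where "As \<in> Mt s" "p = projM s (restr As)" by (auto simp: projM_restr)
  then show "p \<in> PM s" by (simp add: PM_def restr_in_M)
qed

lemma PM_mult_eq:
  assumes "vector_space s" "As \<in> Mt s" "Bs \<in> Mt s"
  shows "PM_mult s (projM s As) (projM s Bs) = projM s (Psi (seq_mult As Bs))"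
  using PM_mult_projM[OF assms] by (simp add: projM_restr)

lemma Phi_eq_first_nonzero:
  assumes "vector_space s" "As \<in> Mt s" "x \<noteq> 0"
  shows "Phi s (projM s As) (pclass s x) = pclass s (first_nonzero As x)"
proof -
  let ?Rs = "restr As"
  have R: "?Rs \<in> M s" using assms(2) by (rule restr_in_M)
  have len: "length ?Rs = length As" by (simp add: restr_def)
  have V: "Vsp ?Rs i = Vsp As i" if "i \<le> length As" for i
    using projM_eqD(2)[OF assms(1) projM_restr] that len by metis
  have end_0: "x \<notin> Vsp As (length As)"
    using assms(2,3) by (simp add: Vsp_length Mt_KA)
  \<comment> \<open>This is the first member of the chain that misses \<open>x\<close>. It is not
    member 0, which is \<open>UNIV\<close>, so the first entry not killing \<open>x\<close> has
    index \<open>j - 1\<close>.\<close>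
  define j where "j = (LEAST j. x \<notin> Vsp As j)"
  have j: "x \<notin> Vsp As j" "j \<le> length As" "\<And>k. k < j \<Longrightarrow> x \<in> Vsp As k"
    unfolding j_def using LeastI[of "\<lambda>j. x \<notin> Vsp As j", OF end_0]
      Least_le[of "\<lambda>j. x \<notin> Vsp As j", OF end_0]
    by (auto dest: not_less_Least)
  then obtain i where i: "j = Suc i" by (cases j) auto
  have "Phi s (projM s ?Rs) (pclass s x) = pclass s ((?Rs ! i) x)"
    by (rule Phi_projM[OF assms(1) R]) (use j i len in \<open>simp_all add: V del: Vsp.simps\<close>)
  also have "(?Rs ! i) x = (As ! i) x"
    using j i by (simp add: restr_def Vsp_eq_K)
  also have "\<dots> = first_nonzero As x"
    using j i by (intro first_nonzero_nth[symmetric]) auto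
  finally show ?thesis by (simp add: projM_restr)
qed

subsection \<open>The homomorphism \<open>Phi\<close>\<close>

lemma monoid_Map_monoid: "Group.monoid (Map_monoid S)"
  by (rule monoidI)
    (auto simp: Map_monoid_def compose_assoc[symmetric] compose_def PiE_iff extensional_def
      fun_eq_iff)

text \<open>\<open>projM s\<close> maps \<open>Mt s\<close> onto the carrier and respects products,
  so the monoid laws pass from lists to their classes.\<close>

lemma monoid_PM_monoid:
  fixes s :: "complex \<Rightarrow> 'v::ab_group_add \<Rightarrow> 'v"
  assumes "vector_space s" "(UNIV :: 'v set) \<noteq> {0}"
  shows "Group.monoid (PM_monoid s)"
proof -
  have one: "\<one>\<^bsub>PM_monoid s\<^esub> = projM s [id]" by (simp add: PM_monoid_def projM_def)
  have car: "carrier (PM_monoid s) = projM s ` Mt s"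
    by (simp add: PM_monoid_def PM_eq_Mt[OF assms(1)])
  have mult: "projM s As \<otimes>\<^bsub>PM_monoid s\<^esub> projM s Bs = projM s (Psi (seq_mult As Bs))"
    if "As \<in> Mt s" "Bs \<in> Mt s" for As Bs
    using PM_mult_eq[OF assms(1) that] by (simp add: PM_monoid_def)
  have closed: "Psi (seq_mult As Bs) \<in> Mt s" if "As \<in> Mt s" "Bs \<in> Mt s" for As Bs
    by (rule Psi_seq_mult_in_Mt) (use assms(2) that in \<open>simp_all add: Mt_def\<close>)
  note id = id_in_Mt[OF assms]
  show ?thesis
  proof (rule monoidI)
    fix p q r
    assume "p \<in> carrier (PM_monoid s)" "q \<in> carrier (PM_monoid s)" "r \<in> carrier (PM_monoid s)"
    then obtain As Bs Cs where *: "As \<in> Mt s" "Bs \<in> Mt s" "Cs \<in> Mt s"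
      "p = projM s As" "q = projM s Bs" "r = projM s Cs"
      unfolding car by blast
    have "Psi (seq_mult (Psi (seq_mult As Bs)) Cs) = Psi (seq_mult As (Psi (seq_mult Bs Cs)))"
      using * by (intro Psi_seq_mult_assoc) (auto simp: Mt_iff)
    then show "p \<otimes>\<^bsub>PM_monoid s\<^esub> q \<otimes>\<^bsub>PM_monoid s\<^esub> r = p \<otimes>\<^bsub>PM_monoid s\<^esub> (q \<otimes>\<^bsub>PM_monoid s\<^esub> r)"
      by (simp add: * mult closed)
  qed (use id in \<open>auto simp: car one mult closed seq_mult_id_left seq_mult_id_right Psi_Mt\<close>)
qed

lemma Phi_in_Map:
  assumes "vector_space s" "p \<in> PM s"
  shows "Phi s p \<in> PV s \<rightarrow>\<^sub>E PV s"
proof -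
  obtain As where As: "As \<in> Mt s" "p = projM s As" using assms by (auto simp: PM_eq_Mt)
  \<comment> \<open>The trivial common kernel keeps the value nonzero, so its class is a point of
    \<open>PV s\<close>.\<close>
  then have "first_nonzero As x \<noteq> 0" if "x \<noteq> 0" for x
    using that by (simp add: first_nonzero_eq_0_iff Mt_KA)
  then have "Phi s p X \<in> PV s" if "X \<in> PV s" for X
    using that Phi_eq_first_nonzero[OF assms(1) As(1)] As(2) by (force simp: PV_def)
  moreover have "Phi s p \<in> extensional (PV s)" by (simp add: Phi_def)
  ultimately show ?thesis by (simp add: PiE_iff)
qed

lemma Phi_PM_mult:
  fixes s :: "complex \<Rightarrow> 'v::ab_group_add \<Rightarrow> 'v"
  assumes "vector_space s" "(UNIV :: 'v set) \<noteq> {0}" "p \<in> PM s" "q \<in> PM s"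
  shows "Phi s (PM_mult s p q) = compose (PV s) (Phi s p) (Phi s q)"
proof
  fix X
  obtain As Bs where *: "As \<in> Mt s" "Bs \<in> Mt s" "p = projM s As" "q = projM s Bs"
    using assms by (auto simp: PM_eq_Mt)
  have Cs: "Psi (seq_mult As Bs) \<in> Mt s"
    using * by (intro Psi_seq_mult_in_Mt assms(2)) (simp_all add: Mt_iff)
  show "Phi s (PM_mult s p q) X = compose (PV s) (Phi s p) (Phi s q) X"
  proof (cases "X \<in> PV s")
    case True
    then obtain x where x: "x \<noteq> 0" "X = pclass s x" by (auto simp: PV_def)
    \<comment> \<open>This allows \<open>Phi_eq_first_nonzero\<close> to be applied a second time,
      at the vector \<open>first_nonzero Bs x\<close>.\<close>
    have "first_nonzero Bs x \<noteq> 0"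
      using x(1) *(2) by (simp add: first_nonzero_eq_0_iff Mt_KA)
    moreover have "KA As = {0}" using *(1) by (rule Mt_KA)
    ultimately show ?thesis
      using True x * Cs
      by (simp add: compose_def PM_mult_eq[OF assms(1)] Phi_eq_first_nonzero[OF assms(1)]
          first_nonzero_Psi first_nonzero_seq_mult)
  \<comment> \<open>Off \<open>PV s\<close> both sides are \<open>undefined\<close>.\<close>
  qed (simp add: compose_def Phi_def)
qed

lemma Phi_one:
  fixes s :: "complex \<Rightarrow> 'v::ab_group_add \<Rightarrow> 'v"
  assumes "vector_space s" "(UNIV :: 'v set) \<noteq> {0}"
  shows "Phi s [pclass (hom_scale s UNIV) id] = (\<lambda>X\<in>PV s. X)"
proof
  fix X
  have one: "[pclass (hom_scale s UNIV) id] = projM s [id]" by (simp add: projM_def)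
  show "Phi s [pclass (hom_scale s UNIV) id] X = (\<lambda>X\<in>PV s. X) X"
  proof (cases "X \<in> PV s")
    case True
    then obtain x where "x \<noteq> 0" "X = pclass s x" by (auto simp: PV_def)
    with True show ?thesis
      unfolding one by (simp add: Phi_eq_first_nonzero[OF assms(1) id_in_Mt[OF assms]])
  qed (simp add: Phi_def)
qed

theorem proposition6p7:
  fixes s :: "complex \<Rightarrow> 'v::ab_group_add \<Rightarrow> 'v" and Basis :: "'v set" and n :: nat
  assumes "finite_dimensional_vector_space s Basis"
    and "vector_space.dim s UNIV = n" and "n \<ge> 1"
  shows "Group.monoid (PM_monoid s)
    \<and> Group.monoid (Map_monoid (PV s))
    \<and> Phi s \<in> hom (PM_monoid s) (Map_monoid (PV s))
    \<and> Phi s \<one>\<^bsub>PM_monoid s\<^esub> = \<one>\<^bsub>Map_monoid (PV s)\<^esub>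
    \<and> monoid_acts (PM_monoid s) (PV s) (Phi s)"
proof -
  interpret finite_dimensional_vector_space s Basis by fact
  have vs: "vector_space s" by unfold_locales
  \<comment> \<open>The bound \<open>n \<ge> 1\<close> enters in this form: it puts
    \<open>[id]\<close> into \<open>Mt s\<close> and keeps the products nonempty.\<close>
  have ne: "(UNIV :: 'v set) \<noteq> {0}"
  proof
    assume "(UNIV :: 'v set) = {0}"
    then have "dim (UNIV :: 'v set) = 0" by (metis dim_eq_0 subset_refl)
    with assms(2,3) show False by simp
  qed
  have mon: "Group.monoid (PM_monoid s)" using vs ne by (rule monoid_PM_monoid)
  have hom: "Phi s \<in> hom (PM_monoid s) (Map_monoid (PV s))"
    by (rule homI)
      (simp_all add: PM_monoid_def Map_monoid_def Phi_in_Map[OF vs] Phi_PM_mult[OF vs ne])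
  have one: "Phi s \<one>\<^bsub>PM_monoid s\<^esub> = \<one>\<^bsub>Map_monoid (PV s)\<^esub>"
    by (simp add: PM_monoid_def Map_monoid_def Phi_one[OF vs ne])
  have "monoid_acts (PM_monoid s) (PV s) (Phi s)"
    unfolding monoid_acts_def
    using mon Phi_in_Map[OF vs] Phi_one[OF vs ne] Phi_PM_mult[OF vs ne]
    by (auto simp: PM_monoid_def compose_def)
  with mon hom one monoid_Map_monoid show ?thesis by blast
qed

end
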